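(* Let $m \ge 1$, $n > t \ge 0$, $p \ge q \ge 2$ be integers and let $X$ be a nonempty set. Let $B_1,\dots,B_m$ be Hamming balls of radius $t$ in $X^n$ centered at $a_1,\dots,a_m \in X^n$, respectively, such that among any $p$ of these balls (with distinct indices), some $q$ of them have a common point. There is an absolute constant $C > 0$ such that: (1) if $X$ is finite and $q \le t+1$, then there exists a set of at most $p^q q^t |X|^{t+2-q} C^{t}$ points of $X^n$ such that every $B_i$ contains at least one of them; (2) if $q = t+2$, then there exists a set of at most $C e^{2t} p^{t+1}$ points of $X^n$ such that every $B_i$ contains at least one of them.
   Context: For $p,q \in X^n$, $\mathrm{dist}(p,q)$ is the Hamming distance (number of coordinates in which they differ). The Hamming ball of radius $t$ centered at $x \in X^n$ is $B(x,t) = \{y \in X^n : \mathrm{dist}(y,x) \le t\}$. (The paper writes the bounds as $p^q q^t |X|^{t+2-q} 2^{O(t)}$ and $O(e^{2t}p^{t+1})$.) *)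

theory Defs
  imports Complex_Main "HOL-Library.FuncSet"
begin

text \<open>Points of \<open>X\<^sup>n\<close> are extensional functions on the coordinate set \<open>{..<n}\<close>, so that two points
  are equal iff they agree in all \<open>n\<close> coordinates.\<close>

abbreviation words :: "nat \<Rightarrow> 'a set \<Rightarrow> (nat \<Rightarrow> 'a) set" where
  "words n X \<equiv> {..<n} \<rightarrow>\<^sub>E X"

definition hamming_dist :: "nat \<Rightarrow> (nat \<Rightarrow> 'a) \<Rightarrow> (nat \<Rightarrow> 'a) \<Rightarrow> nat" where
  "hamming_dist n x y = card {i. i < n \<and> x i \<noteq> y i}"

definition hamming_ball :: "nat \<Rightarrow> 'a set \<Rightarrow> (nat \<Rightarrow> 'a) \<Rightarrow> nat \<Rightarrow> (nat \<Rightarrow> 'a) set" where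
  "hamming_ball n X x t = {y \<in> words n X. hamming_dist n y x \<le> t}"

text \<open>Among any \<open>p\<close> members of the family \<open>B 0, \<dots>, B (m - 1)\<close>, some \<open>q\<close> have a common point.
  Members are counted by index, so repeated sets count with multiplicity.\<close>

definition pq_property :: "nat \<Rightarrow> nat \<Rightarrow> nat \<Rightarrow> (nat \<Rightarrow> 'b set) \<Rightarrow> bool" where
  "pq_property p q m B \<longleftrightarrow>
     (\<forall>I \<subseteq> {..<m}. card I = p \<longrightarrow> (\<exists>J \<subseteq> I. card J = q \<and> (\<exists>y. \<forall>j\<in>J. y \<in> B j)))"

definition pierceable :: "'b set \<Rightarrow> nat \<Rightarrow> (nat \<Rightarrow> 'b set) \<Rightarrow> real \<Rightarrow> bool" where
  "pierceable V m B N \<longleftrightarrow>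
     (\<exists>S \<subseteq> V. finite S \<and> real (card S) \<le> N \<and> (\<forall>i<m. \<exists>s\<in>S. s \<in> B i))"

text \<open>The real \<open>C\<close> is a valid constant in both bounds, for every system of Hamming balls over the
  alphabet \<open>X\<close>.\<close>

definition piercing_bounds :: "real \<Rightarrow> 'a set \<Rightarrow> bool" where
  "piercing_bounds C X \<longleftrightarrow>
     (\<forall>m n t p q. \<forall>a :: nat \<Rightarrow> nat \<Rightarrow> 'a.
        m \<ge> 1 \<and> n > t \<and> p \<ge> q \<and> q \<ge> 2 \<and>
        (\<forall>i<m. a i \<in> words n X) \<and>
        pq_property p q m (\<lambda>i. hamming_ball n X (a i) t) \<longrightarrow>
          (finite X \<and> q \<le> t + 1 \<longrightarrow>
             pierceable (words n X) m (\<lambda>i. hamming_ball n X (a i) t)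
               (real p ^ q * real q ^ t * real (card X) ^ (t + 2 - q) * C ^ t)) \<and>
          (q = t + 2 \<longrightarrow>
             pierceable (words n X) m (\<lambda>i. hamming_ball n X (a i) t)
               (C * exp (2 * real t) * real p ^ (t + 1))))"

text \<open>HOL cannot quantify over types below an existential quantifier: in
  \<open>\<exists>C. \<forall>X :: 'a set. \<dots>\<close> the constant could depend on the type \<open>'a\<close> of the alphabet.
  That \<open>C\<close> is absolute is therefore expressed in two parts: some \<open>C\<close> works for all alphabets
  \<open>X :: nat set\<close>, and every such \<open>C\<close> works for all alphabets over an arbitrary type. Together
  these give one \<open>C\<close>, not depending on \<open>'a\<close>, that works for all nonempty alphabets of every type.\<close>

end

theory Submission
  imports Defs
begin

text \<open>A maximal set of centres at pairwise distance more than \<open>2t\<close> has fewer than \<open>p\<close> elements, so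
  it suffices to pierce the balls whose centres \<open>v\<close> have a fixed distance \<open>t + d\<close>, \<open>d \<le> t\<close>, from one
  word \<open>c\<close>. Put \<open>k = t + 2 - q\<close> and regard \<open>v\<close> as the set of pairs \<open>(i, v i)\<close> with \<open>v i \<noteq> c i\<close>. Select
  centres greedily, keeping \<open>v\<close> if it has fewer than \<open>d - k\<close> pairs in the union \<open>U\<close> of those
  selected so far, or differs from \<open>c\<close> in fewer than \<open>d\<close> common places with each of them. No \<open>q\<close>
  selected balls have a common point, so fewer than \<open>p\<close> are selected. Every other \<open>v\<close> is then within
  \<open>t\<close> of a word obtained from \<open>c\<close> by changing at most \<open>k\<close> letters in places where a single selected
  centre differs from \<open>c\<close>, with arbitrary new letters, and \<open>d - k\<close> letters according to pairs of
  \<open>U\<close>. Counting these words with \<open>N choose j \<le> N^j / j!\<close> and \<open>x^j / j! \<le> exp x\<close> gives \<open>C = exp 5\<close>.\<close>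

section \<open>Greedy selection in the order of indices\<close>

text \<open>Indices are examined in increasing order and kept iff those kept before do not cover
  them. A rejected index was covered by a subset of the final \<open>M\<close>, so
  \<open>mono\<close> makes it covered by \<open>M\<close>.\<close>

lemma greedy_maximal:
  fixes F :: "nat set"
  assumes "finite F"
    and mono: "\<And>i M M'. cov i M \<Longrightarrow> M \<subseteq> M' \<Longrightarrow> M' \<subseteq> F \<Longrightarrow> cov i M'"
  obtains M where "M \<subseteq> F" "\<And>i. i \<in> M \<Longrightarrow> \<not> cov i {j \<in> M. j < i}"
    "\<And>i. i \<in> F - M \<Longrightarrow> cov i M"
proof -
  have "G \<subseteq> F \<Longrightarrow> \<exists>M\<subseteq>G. (\<forall>i\<in>M. \<not> cov i {j \<in> M. j < i}) \<and> (\<forall>i\<in>G - M. cov i M)"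
    if "finite G" for G
    using that
  proof (induction G rule: finite_linorder_max_induct)
    case empty
    then show ?case by simp
  next
    case (insert b A)
    then obtain M where M: "M \<subseteq> A" "\<forall>i\<in>M. \<not> cov i {j \<in> M. j < i}" "\<forall>i\<in>A - M. cov i M"
      by auto
    show ?case
    proof (cases "cov b M")
      case True
      then show ?thesis using M by (intro exI[of _ M]) auto
    next
      case False
      have b: "{j \<in> insert b M. j < b} = M" using M(1) insert(2) by auto
      have o: "{j \<in> insert b M. j < i} = {j \<in> M. j < i}" if "i \<in> M" for i
        using insert(2) that M(1) by force
      have "\<forall>i\<in>insert b M. \<not> cov i {j \<in> insert b M. j < i}"
        using M(2) b o False by auto
      moreover have "\<forall>i\<in>insert b A - insert b M. cov i (insert b M)"
        using M(1,3) insert(4) mono[of _ M "insert b M"] by blast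
      ultimately show ?thesis using M(1) by (intro exI[of _ "insert b M"]) auto
    qed
  qed
  from this[OF assms(1) order_refl] show thesis using that by blast
qed

section \<open>Hamming distance in terms of deviations from a reference word\<close>

lemma hamming_dist_commute: "hamming_dist n x y = hamming_dist n y x"
  unfolding hamming_dist_def by metis

lemma hamming_dist_triangle:
  "hamming_dist n x y \<le> hamming_dist n x z + hamming_dist n z y"
proof -
  have "hamming_dist n x y \<le> card ({i. i < n \<and> x i \<noteq> z i} \<union> {i. i < n \<and> z i \<noteq> y i})"
    unfolding hamming_dist_def by (intro card_mono) auto
  also have "\<dots> \<le> hamming_dist n x z + hamming_dist n z y"
    unfolding hamming_dist_def by (rule card_Un_le)
  finally show ?thesis .
qed

definition diff_support :: "nat \<Rightarrow> (nat \<Rightarrow> 'a) \<Rightarrow> (nat \<Rightarrow> 'a) \<Rightarrow> nat set" where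
  "diff_support n c v = {i. i < n \<and> v i \<noteq> c i}"

definition diff_graph :: "nat \<Rightarrow> (nat \<Rightarrow> 'a) \<Rightarrow> (nat \<Rightarrow> 'a) \<Rightarrow> (nat \<times> 'a) set" where
  "diff_graph n c v = (\<lambda>i. (i, v i)) ` diff_support n c v"

lemma finite_diff_support [simp]: "finite (diff_support n c v)"
  unfolding diff_support_def by simp

lemma finite_diff_graph [simp]: "finite (diff_graph n c v)"
  unfolding diff_graph_def by simp

lemma card_diff_support: "card (diff_support n c v) = hamming_dist n v c"
  unfolding diff_support_def hamming_dist_def ..

lemma card_diff_graph: "card (diff_graph n c v) = hamming_dist n v c"
  unfolding diff_graph_def by (subst card_image) (auto simp: inj_on_def card_diff_support)

lemma mem_diff_graph: "(i, x) \<in> diff_graph n c v \<longleftrightarrow> i < n \<and> v i \<noteq> c i \<and> x = v i"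
  unfolding diff_graph_def diff_support_def by auto

text \<open>A place in just one of the two supports is a disagreement of \<open>v\<close> and
  \<open>w\<close>, so the union has at most \<open>2 * t\<close> elements beyond the intersection,
  while the two cardinalities sum to \<open>2 * s\<close>.\<close>

lemma card_diff_support_Int:
  assumes "hamming_dist n v c = s" "hamming_dist n w c = s" "hamming_dist n v w \<le> 2 * t"
  shows "s \<le> t + card (diff_support n c v \<inter> diff_support n c w)"
proof -
  let ?V = "diff_support n c v" and ?W = "diff_support n c w"
  have "card (?V \<union> ?W) \<le> card ({i. i < n \<and> v i \<noteq> w i} \<union> (?V \<inter> ?W))"
    by (intro card_mono) (auto simp: diff_support_def)
  also have "\<dots> \<le> hamming_dist n v w + card (?V \<inter> ?W)"
    unfolding hamming_dist_def by (rule card_Un_le)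
  finally have "card (?V \<union> ?W) \<le> hamming_dist n v w + card (?V \<inter> ?W)" .
  moreover have "card ?V + card ?W = card (?V \<union> ?W) + card (?V \<inter> ?W)"
    by (rule card_Un_Int) auto
  ultimately show ?thesis using assms by (simp add: card_diff_support)
qed

text \<open>At a place where \<open>v\<close> differs from \<open>c\<close>, either \<open>y\<close>
  disagrees with \<open>v\<close> or both words carry the same new letter and share a pair.\<close>

lemma card_diff_graph_Int:
  "hamming_dist n v c \<le> hamming_dist n y v + card (diff_graph n c v \<inter> diff_graph n c y)"
proof -
  have "diff_support n c v \<subseteq> {i. i < n \<and> y i \<noteq> v i} \<union> fst ` (diff_graph n c v \<inter> diff_graph n c y)"
  proof
    fix i assume i: "i \<in> diff_support n c v"
    show "i \<in> {i. i < n \<and> y i \<noteq> v i} \<union> fst ` (diff_graph n c v \<inter> diff_graph n c y)"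
    proof (cases "y i = v i")
      case True
      then have "(i, v i) \<in> diff_graph n c v \<inter> diff_graph n c y"
        using i by (auto simp: diff_support_def mem_diff_graph)
      then show ?thesis by (metis UnI2 fst_conv image_eqI)
    qed (use i in \<open>auto simp: diff_support_def\<close>)
  qed
  then have "card (diff_support n c v) \<le>
      card ({i. i < n \<and> y i \<noteq> v i} \<union> fst ` (diff_graph n c v \<inter> diff_graph n c y))"
    by (intro card_mono) auto
  also have "\<dots> \<le> card {i. i < n \<and> y i \<noteq> v i} + card (fst ` (diff_graph n c v \<inter> diff_graph n c y))"
    by (rule card_Un_le)
  also have "\<dots> \<le> hamming_dist n y v + card (diff_graph n c v \<inter> diff_graph n c y)"
    unfolding hamming_dist_def by (intro add_left_mono card_image_le) auto
  finally show ?thesis by (simp add: card_diff_support)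
qed

section \<open>Selection of fewer than \<open>p\<close> centres at a common distance from
  \<open>c\<close>\<close>

text \<open>If every centre brought at least \<open>t + 3 - q\<close> agreements with \<open>y\<close> not shared with earlier
  centres, then \<open>y\<close> would differ from \<open>c\<close> in more places than it does, because
  \<open>(q - 1) * (t + 3 - q) > t\<close>.\<close>

lemma common_point_overlap:
  fixes v :: "nat \<Rightarrow> nat \<Rightarrow> 'a"
  assumes "card J = q" "2 \<le> q" "q \<le> t + 2"
    and s: "\<And>j. j \<in> J \<Longrightarrow> hamming_dist n (v j) c = s"
    and y: "\<And>j. j \<in> J \<Longrightarrow> hamming_dist n y (v j) \<le> t"
  shows "\<exists>j\<in>J. j \<noteq> Min J \<and>
    s \<le> t + (t + 2 - q) + card (diff_graph n c (v j) \<inter> (\<Union>i\<in>{i\<in>J. i < j}. diff_graph n c (v i)))"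
proof (rule ccontr)
  assume contr: "\<not> ?thesis"
  define k where "k = t + 2 - q"
  define r where "r = hamming_dist n y c"
  define A where "A j = diff_graph n c (v j) \<inter> diff_graph n c y" for j
  \<comment> \<open>These are the agreements of \<open>v j\<close> with \<open>y\<close> that no
    earlier member of \<open>J\<close> shares. They are pairwise disjoint, so their sizes add up to
    at most \<open>r\<close>.\<close>
  define N where "N j = A j - (\<Union>i\<in>{i\<in>J. i < j}. A i)" for j
  have fJ: "finite J" "J \<noteq> {}" using assms(1,2) by (auto intro: card_ge_0_finite)
  have fA: "finite (A j)" for j by (simp add: A_def)
  have As: "s \<le> t + card (A j)" if "j \<in> J" for j
    using card_diff_graph_Int[of n "v j" c y] s[OF that] y[OF that] by (simp add: A_def)
  \<comment> \<open>The overlap bound with centre and common point exchanged. It caps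
    \<open>r\<close> and is contradicted at the end for \<open>Min J\<close>.\<close>
  have Ar: "r \<le> t + card (A j)" if "j \<in> J" for j
    using card_diff_graph_Int[of n y c "v j"] y[OF that]
    by (simp add: A_def r_def hamming_dist_commute Int_commute)
  have N: "k + 1 \<le> card (N j)" if j: "j \<in> J - {Min J}" for j
  proof -
    let ?U = "\<Union>i\<in>{i\<in>J. i < j}. diff_graph n c (v i)"
    have "card (A j) \<le> card (N j \<union> (diff_graph n c (v j) \<inter> ?U))"
      by (intro card_mono) (auto simp: N_def A_def)
    also have "\<dots> \<le> card (N j) + card (diff_graph n c (v j) \<inter> ?U)"
      by (rule card_Un_le)
    \<comment> \<open>By the negated goal \<open>s\<close> exceeds \<open>t + k\<close> plus the
      overlap with \<open>?U\<close>, whereas \<open>s \<le> t + card (A j)\<close>. Hence more than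
      \<open>k\<close> agreements are new.\<close>
    finally show ?thesis using contr j As[of j] unfolding k_def by fastforce
  qed
  have Nmin: "N (Min J) = A (Min J)"
    using fJ by (auto simp: N_def)
  have "card (\<Union>j\<in>J. N j) = (\<Sum>j\<in>J. card (N j))"
  proof (rule card_UN_disjoint)
    show "\<forall>i\<in>J. \<forall>j\<in>J. i \<noteq> j \<longrightarrow> N i \<inter> N j = {}"
    proof (intro ballI impI)
      fix i j assume "i \<in> J" "j \<in> J" "i \<noteq> j"
      then show "N i \<inter> N j = {}"
        by (cases "i < j") (auto simp: N_def)
    qed
  qed (use fJ in \<open>auto simp: N_def A_def\<close>)
  also have "\<dots> = card (N (Min J)) + (\<Sum>j\<in>J - {Min J}. card (N j))"
    using fJ by (intro sum.remove) auto
  also have "\<dots> \<ge> card (A (Min J)) + (\<Sum>j\<in>J - {Min J}. k + 1)"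
    unfolding Nmin by (intro add_left_mono sum_mono N)
  finally have "card (A (Min J)) + (q - 1) * (k + 1) \<le> card (\<Union>j\<in>J. N j)"
    using fJ assms(1) by simp
  also have "\<dots> \<le> card (diff_graph n c y)"
    by (intro card_mono) (auto simp: N_def A_def)
  also have "\<dots> = r" by (simp add: card_diff_graph r_def)
  finally have "card (A (Min J)) + (q - 1) * (k + 1) \<le> r" .
  moreover have "t < (q - 1) * (k + 1)"
  proof -
    \<comment> \<open>With \<open>q = u + 2\<close> and \<open>t = k + u\<close>, the product
      \<open>(u + 1) * (k + 1)\<close> exceeds its part \<open>u + k\<close>.\<close>
    obtain u where u: "q = u + 2" using assms(2) by (metis add.commute le_Suc_ex)
    have "t = k + u" using u assms(3) by (simp add: k_def)
    then show ?thesis using u by simp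
  qed
  ultimately show False using Ar[of "Min J"] fJ by simp
qed

lemma pq_property_obtain:
  assumes "pq_property p q m B" "M \<subseteq> {..<m}" "\<not> card M < p"
  obtains J y where "J \<subseteq> M" "card J = q" "\<And>j. j \<in> J \<Longrightarrow> y \<in> B j"
proof -
  obtain I where I: "I \<subseteq> M" "card I = p"
    using assms(3) by (meson not_less obtain_subset_with_card_n)
  with assms(2) have "I \<subseteq> {..<m}" by blast
  with I(2) assms(1) obtain J where "J \<subseteq> I" "card J = q" "\<exists>y. \<forall>j\<in>J. y \<in> B j"
    unfolding pq_property_def by blast
  with I(1) show thesis using that by blast
qed

text \<open>An index is selected when either half of \<open>cov\<close> fails. Were \<open>p\<close>
  indices selected, \<open>q\<close> of their balls would share a point \<open>y\<close>. Then
  \<open>common_point_overlap\<close> yields a member \<open>j\<close> satisfying the second half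
  with respect to earlier members. The first half holds with witness \<open>Min J\<close>, because
  balls sharing \<open>y\<close> have centres at distance at most \<open>2 * t\<close>. Such a
  \<open>j\<close> would not have been selected.\<close>

lemma pq_select:
  fixes a :: "nat \<Rightarrow> nat \<Rightarrow> 'a"
  assumes pq: "pq_property p q m (\<lambda>i. hamming_ball n X (a i) t)"
    and "2 \<le> q" "q \<le> t + 2" "F \<subseteq> {..<m}"
    and s: "\<And>i. i \<in> F \<Longrightarrow> hamming_dist n (a i) c = s"
  obtains M where "M \<subseteq> F" "card M < p"
    "\<And>i. i \<in> F \<Longrightarrow> \<exists>w\<in>M. s \<le> t + card (diff_support n c (a i) \<inter> diff_support n c (a w))"
    "\<And>i. i \<in> F \<Longrightarrow>
       s \<le> t + (t + 2 - q) + card (diff_graph n c (a i) \<inter> (\<Union>w\<in>M. diff_graph n c (a w)))"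
proof -
  define cov where "cov i M \<longleftrightarrow>
     (\<exists>w\<in>M. s \<le> t + card (diff_support n c (a i) \<inter> diff_support n c (a w))) \<and>
     s \<le> t + (t + 2 - q) + card (diff_graph n c (a i) \<inter> (\<Union>w\<in>M. diff_graph n c (a w)))" for i M
  have fF: "finite F" using assms(4) finite_subset by blast
  have mono: "cov i M'" if "cov i M" "M \<subseteq> M'" for i M M'
  proof -
    have "card (diff_graph n c (a i) \<inter> (\<Union>w\<in>M. diff_graph n c (a w)))
        \<le> card (diff_graph n c (a i) \<inter> (\<Union>w\<in>M'. diff_graph n c (a w)))"
      using that(2) by (intro card_mono) auto
    with that(1) have "s \<le> t + (t + 2 - q) +
        card (diff_graph n c (a i) \<inter> (\<Union>w\<in>M'. diff_graph n c (a w)))"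
      unfolding cov_def by linarith
    with that show ?thesis unfolding cov_def by blast
  qed
  obtain M where M: "M \<subseteq> F" "\<And>i. i \<in> M \<Longrightarrow> \<not> cov i {j \<in> M. j < i}"
    "\<And>i. i \<in> F - M \<Longrightarrow> cov i M"
  proof (rule greedy_maximal[OF fF, of cov])
    show "cov i M'" if "cov i M" "M \<subseteq> M'" for i M M'
      using mono that .
  qed (rule that)
  \<comment> \<open>A selected index is covered once it belongs to \<open>M\<close> itself, so the
    conclusion reaches all of \<open>F\<close>.\<close>
  have self: "cov i M" if "i \<in> M" for i
  proof -
    have "diff_graph n c (a i) \<inter> (\<Union>w\<in>M. diff_graph n c (a w)) = diff_graph n c (a i)"
      using that by auto
    moreover have "s \<le> t + card (diff_support n c (a i) \<inter> diff_support n c (a i))"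
      using s[of i] that M(1) by (auto simp: card_diff_support)
    ultimately show ?thesis
      using s[of i] that M(1) unfolding cov_def by (metis card_diff_graph subsetD trans_le_add2 order_refl)
  qed
  have MM: "M \<subseteq> {..<m}" using M(1) assms(4) by blast
  have "card M < p"
  proof (rule ccontr)
    assume "\<not> card M < p"
    then obtain J y where J: "J \<subseteq> M" "card J = q" and y: "\<And>j. j \<in> J \<Longrightarrow> y \<in> hamming_ball n X (a j) t"
      using pq_property_obtain[OF pq MM] by blast
    note JM = J(1)
    have fJ: "finite J" "J \<noteq> {}" using assms(2) J(2) by (auto intro: card_ge_0_finite)
    have yd: "hamming_dist n y (a j) \<le> t" if "j \<in> J" for j
      using y that by (simp add: hamming_ball_def)
    have sJ: "hamming_dist n (a j) c = s" if "j \<in> J" for j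
      using that JM M(1) s by blast
    have "\<exists>j\<in>J. j \<noteq> Min J \<and> s \<le> t + (t + 2 - q) +
        card (diff_graph n c (a j) \<inter> (\<Union>i\<in>{i\<in>J. i < j}. diff_graph n c (a i)))"
      by (rule common_point_overlap[OF J(2) assms(2,3) sJ yd])
    then obtain j where j: "j \<in> J" "j \<noteq> Min J" and
      ov: "s \<le> t + (t + 2 - q) +
        card (diff_graph n c (a j) \<inter> (\<Union>i\<in>{i\<in>J. i < j}. diff_graph n c (a i)))"
      by (elim bexE conjE) (rule that)
    have lt: "Min J < j" "Min J \<in> J"
      using Min_le[OF fJ(1) j(1)] j(2) Min_in[OF fJ] by linarith+
    have "hamming_dist n (a j) (a (Min J)) \<le> 2 * t"
      using hamming_dist_triangle[of n "a j" "a (Min J)" y] yd[OF j(1)] yd[OF lt(2)]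
      by (simp add: hamming_dist_commute)
    then have "s \<le> t + card (diff_support n c (a j) \<inter> diff_support n c (a (Min J)))"
      using s lt(2) j(1) JM M(1) by (intro card_diff_support_Int) auto
    with ov lt have "cov j {i\<in>J. i < j}" unfolding cov_def by blast
    then have "cov j {i\<in>M. i < j}" using JM by (elim mono) auto
    with M(2) j(1) JM show False by blast
  qed
  moreover have "cov i M" if "i \<in> F" for i
    using that self M(3) by blast
  ultimately show thesis using that[OF M(1)] unfolding cov_def by blast
qed

section \<open>Points obtained by changing letters of \<open>c\<close>\<close>

text \<open>\<open>L\<close> ranges over all sets of pairs, including those that are not graphs of functions, for
  which the choice of the new letter is immaterial.\<close>

definition override_graph :: "(nat \<Rightarrow> 'a) \<Rightarrow> (nat \<times> 'a) set \<Rightarrow> nat \<Rightarrow> 'a" where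
  "override_graph c L = (\<lambda>i. if \<exists>x. (i, x) \<in> L then SOME x. (i, x) \<in> L else c i)"

lemma override_graph_words:
  assumes "c \<in> words n X" "L \<subseteq> {..<n} \<times> X"
  shows "override_graph c L \<in> words n X"
proof -
  have "(SOME x. (i, x) \<in> L) \<in> X" if "(i, x) \<in> L" for i x
    using someI[of "\<lambda>x. (i, x) \<in> L", OF that] assms(2) by auto
  then show ?thesis using assms
    by (auto simp: override_graph_def PiE_iff extensional_def)
qed

text \<open>Each pair in \<open>L\<close> installs the letter of \<open>v\<close> at a separate
  place where \<open>c\<close> differs from \<open>v\<close>, so exactly \<open>card L\<close>
  disagreements disappear.\<close>

lemma override_graph_hamming_dist:
  assumes "L \<subseteq> diff_graph n c v" "hamming_dist n v c \<le> t + card L"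
  shows "hamming_dist n (override_graph c L) v \<le> t"
proof -
  \<comment> \<open>As part of a graph, \<open>L\<close> has one letter per place, so the choice in
    \<open>override_graph\<close> is forced.\<close>
  have inj: "inj_on fst L"
    by (auto simp: inj_on_def mem_diff_graph dest!: subsetD[OF assms(1)])
  have ov: "override_graph c L i = (if i \<in> fst ` L then v i else c i)" for i
  proof (cases "i \<in> fst ` L")
    case True
    then obtain x where x: "(i, x) \<in> L" by auto
    then have "(i, SOME x. (i, x) \<in> L) \<in> L" by (rule someI)
    then have "(SOME x. (i, x) \<in> L) = v i" using assms(1) by (auto simp: mem_diff_graph)
    then show ?thesis using x True by (auto simp: override_graph_def)
  next
    case False
    then show ?thesis by (force simp: override_graph_def)
  qed
  have sub: "fst ` L \<subseteq> diff_support n c v"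
    using assms(1) by (force simp: mem_diff_graph diff_support_def)
  have "{i. i < n \<and> override_graph c L i \<noteq> v i} = diff_support n c v - fst ` L"
    by (auto simp: ov diff_support_def)
  then have "hamming_dist n (override_graph c L) v = card (diff_support n c v) - card (fst ` L)"
    unfolding hamming_dist_def using sub by (metis card_Diff_subset finite_diff_support finite_subset)
  then show ?thesis using assms(2) by (simp add: card_image[OF inj] card_diff_support)
qed

lemma diff_graph_subset: "v \<in> words n X \<Longrightarrow> diff_graph n c v \<subseteq> {..<n} \<times> X"
  by (auto simp: mem_diff_graph PiE_iff)

text \<open>A centre at distance \<open>t + d\<close> comes within \<open>t\<close> of
  \<open>c\<close> once \<open>d\<close> of its letters are copied into \<open>c\<close>.
  \<open>L\<close> supplies those found among pairs of selected centres, \<open>K\<close> the rest,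
  at places controlled by one selected centre. With truncated subtraction the two sizes always sum
  to \<open>d\<close>.\<close>

lemma layer_pierced:
  fixes a :: "nat \<Rightarrow> nat \<Rightarrow> 'a"
  assumes pq: "pq_property p q m (\<lambda>i. hamming_ball n X (a i) t)"
    and q: "2 \<le> q" "q \<le> t + 2" and c: "c \<in> words n X"
    and a: "\<And>i. i < m \<Longrightarrow> a i \<in> words n X"
  obtains M where "M \<subseteq> {..<m}" "card M < p"
    "\<And>w. w \<in> M \<Longrightarrow> hamming_dist n (a w) c = t + d"
    "\<And>i. i < m \<Longrightarrow> hamming_dist n (a i) c = t + d \<Longrightarrow> \<exists>w\<in>M. \<exists>K L.
       finite K \<and> K \<subseteq> diff_support n c (a w) \<times> X \<and> card K = min (t + 2 - q) d \<and>
       L \<subseteq> (\<Union>w\<in>M. diff_graph n c (a w)) \<and> card L = d - (t + 2 - q) \<and>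
       override_graph c (K \<union> L) \<in> hamming_ball n X (a i) t"
proof -
  define k where "k = t + 2 - q"
  define F where "F = {i. i < m \<and> hamming_dist n (a i) c = t + d}"
  have F: "F \<subseteq> {..<m}" by (auto simp: F_def)
  have FD: "i \<in> F \<Longrightarrow> hamming_dist n (a i) c = t + d" for i by (simp add: F_def)
  obtain M where M: "M \<subseteq> F" "card M < p"
    and sup: "\<And>i. i \<in> F \<Longrightarrow>
      \<exists>w\<in>M. t + d \<le> t + card (diff_support n c (a i) \<inter> diff_support n c (a w))"
    and gr: "\<And>i. i \<in> F \<Longrightarrow> t + d \<le> t + (t + 2 - q) +
      card (diff_graph n c (a i) \<inter> (\<Union>w\<in>M. diff_graph n c (a w)))"
    using pq_select[OF pq q F FD] by metis
  define U where "U = (\<Union>w\<in>M. diff_graph n c (a w))"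
  have "\<exists>w\<in>M. \<exists>K L. finite K \<and> K \<subseteq> diff_support n c (a w) \<times> X \<and> card K = min k d \<and>
      L \<subseteq> U \<and> card L = d - k \<and> override_graph c (K \<union> L) \<in> hamming_ball n X (a i) t"
    if i: "i \<in> F" for i
  proof -
    have aX: "a i \<in> words n X" using a i F by auto
    obtain w where w: "w \<in> M" "d \<le> card (diff_support n c (a i) \<inter> diff_support n c (a w))"
      using sup[OF i] by auto
    \<comment> \<open>The places are shared with \<open>a w\<close> but the letters come from
      \<open>a i\<close>. This is why \<open>K\<close> ranges over a product with \<open>X\<close>
      rather than over pairs of selected centres.\<close>
    define E where "E = (\<lambda>j. (j, a i j)) ` (diff_support n c (a i) \<inter> diff_support n c (a w))"
    have cE: "d \<le> card E" unfolding E_def using w by (subst card_image) (auto simp: inj_on_def)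
    have E: "finite E" "E \<subseteq> diff_graph n c (a i)" "E \<subseteq> diff_support n c (a w) \<times> X"
      using aX by (auto simp: E_def diff_graph_def diff_support_def PiE_iff)
    have "d - k \<le> card (diff_graph n c (a i) \<inter> U)"
      using gr[OF i] unfolding k_def U_def by linarith
    then obtain L where L: "L \<subseteq> diff_graph n c (a i) \<inter> U" "card L = d - k"
      by (metis obtain_subset_with_card_n)
    then have fL: "finite L" using finite_subset by fastforce
    \<comment> \<open>\<open>L\<close> may already use up to \<open>d - k\<close> elements of
      \<open>E\<close>. Of at least \<open>d\<close> elements, \<open>min k d\<close> therefore
      remain for \<open>K\<close>.\<close>
    have "card E \<le> card (E - L) + card L"
      using diff_card_le_card_Diff[OF fL, of E] by linarith
    then have "min k d \<le> card (E - L)" using cE L(2) by linarith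
    then obtain K where K: "K \<subseteq> E - L" "card K = min k d" "finite K"
      by (metis obtain_subset_with_card_n)
    have "card (K \<union> L) = min k d + (d - k)"
      using K L(2) fL by (subst card_Un_disjoint) auto
    then have cKL: "t + d \<le> t + card (K \<union> L)" by linarith
    have KL: "K \<union> L \<subseteq> diff_graph n c (a i)" using K L E by auto
    have "override_graph c (K \<union> L) \<in> hamming_ball n X (a i) t"
      using override_graph_words[OF c order_trans[OF KL diff_graph_subset[OF aX]]]
        override_graph_hamming_dist[OF KL] cKL FD[OF i] by (simp add: hamming_ball_def)
    then show ?thesis using w(1) K L E(3) by blast
  qed
  then show thesis
    using that[of M] M F unfolding F_def U_def k_def by blast
qed

section \<open>From single layers to all balls\<close>

text \<open>Balls sharing a point have centres within \<open>2 * t\<close>, so by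
  \<open>q \<ge> 2\<close> fewer than \<open>p\<close> centres can be pairwise farther apart. A
  maximal such choice gives the reference words \<open>c\<close>. Each serves the centres within
  \<open>2 * t\<close> of it, layer by layer, and \<open>b\<close> bounds the points spent per
  reference word.\<close>

lemma pierceable_from_layers:
  fixes a :: "nat \<Rightarrow> nat \<Rightarrow> 'a"
  assumes pq: "pq_property p q m (\<lambda>i. hamming_ball n X (a i) t)" and q: "2 \<le> q"
    and a: "\<And>i. i < m \<Longrightarrow> a i \<in> words n X"
    and layer: "\<And>c d. c \<in> words n X \<Longrightarrow> d \<in> {1..t} \<Longrightarrow>
      \<exists>S\<subseteq>words n X. finite S \<and> real (card S) \<le> f d \<and>
        (\<forall>i<m. hamming_dist n (a i) c = t + d \<longrightarrow> (\<exists>s\<in>S. s \<in> hamming_ball n X (a i) t))"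
    and b0: "0 \<le> b" and b: "1 + (\<Sum>d\<in>{1..t}. f d) \<le> b"
  shows "pierceable (words n X) m (\<lambda>i. hamming_ball n X (a i) t) (real p * b)"
proof -
  define cov where "cov i M \<longleftrightarrow> (\<exists>j\<in>M. hamming_dist n (a i) (a j) \<le> 2 * t)" for i and M :: "nat set"
  obtain M where M: "M \<subseteq> {..<m}" "\<And>i. i \<in> M \<Longrightarrow> \<not> cov i {j \<in> M. j < i}"
    "\<And>i. i \<in> {..<m} - M \<Longrightarrow> cov i M"
  proof (rule greedy_maximal[of "{..<m}" cov])
    show "cov i M'" if "cov i M" "M \<subseteq> M'" for i M M'
      using that unfolding cov_def by blast
  qed (auto intro: that)
  have covM: "cov i M" if "i < m" for i
    using that M(3)[of i] by (cases "i \<in> M") (force simp: cov_def hamming_dist_def)+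
  have "card M < p"
  proof (rule ccontr)
    assume "\<not> card M < p"
    then obtain J y where J: "J \<subseteq> M" "card J = q" and y: "\<And>j. j \<in> J \<Longrightarrow> y \<in> hamming_ball n X (a j) t"
      using pq_property_obtain[OF pq M(1)] by blast
    have "\<not> is_singleton J" "J \<noteq> {}"
      using J(2) q by (auto simp: is_singleton_altdef)
    then obtain i j where ij: "i \<in> J" "j \<in> J" "i < j"
      by (metis is_singletonI' linorder_neqE_nat)
    have "hamming_dist n (a j) (a i) \<le> 2 * t"
      using hamming_dist_triangle[of n "a j" "a i" y] y[OF ij(1)] y[OF ij(2)]
      by (simp add: hamming_ball_def hamming_dist_commute)
    then have "cov j {i\<in>M. i < j}" using ij J unfolding cov_def by blast
    with M(2) ij J show False by blast
  qed
  have "\<exists>S. \<forall>c\<in>words n X. \<forall>d\<in>{1..t}. S c d \<subseteq> words n X \<and> finite (S c d) \<and> real (card (S c d)) \<le> f d \<and>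
        (\<forall>i<m. hamming_dist n (a i) c = t + d \<longrightarrow> (\<exists>s\<in>S c d. s \<in> hamming_ball n X (a i) t))"
    using layer by metis
  then obtain S where S: "\<And>c d. c \<in> words n X \<Longrightarrow> d \<in> {1..t} \<Longrightarrow> S c d \<subseteq> words n X \<and> finite (S c d) \<and>
        real (card (S c d)) \<le> f d \<and>
        (\<forall>i<m. hamming_dist n (a i) c = t + d \<longrightarrow> (\<exists>s\<in>S c d. s \<in> hamming_ball n X (a i) t))"
    by blast
  \<comment> \<open>The word \<open>c\<close> itself lies in every ball whose centre is within
    \<open>t\<close> of it. It accounts for the \<open>1\<close> in the bound on \<open>b\<close>
    and leaves the layers from \<open>1\<close> to \<open>t\<close>.\<close>
  define T where "T c = insert c (\<Union>d\<in>{1..t}. S c d)" for c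
  have T: "T c \<subseteq> words n X" "finite (T c)" "real (card (T c)) \<le> b" if c: "c \<in> words n X" for c
  proof -
    show "T c \<subseteq> words n X" using S[OF c] c unfolding T_def by blast
    show "finite (T c)" using S[OF c] unfolding T_def by blast
    have "card (T c) \<le> 1 + card (\<Union>d\<in>{1..t}. S c d)"
      using card_Un_le[of "{c}" "\<Union>d\<in>{1..t}. S c d"] by (simp add: T_def)
    also have "\<dots> \<le> 1 + (\<Sum>d\<in>{1..t}. card (S c d))"
      by (intro add_left_mono card_UN_le) auto
    finally have "real (card (T c)) \<le> 1 + (\<Sum>d\<in>{1..t}. real (card (S c d)))"
      by (simp flip: of_nat_sum)
    also have "\<dots> \<le> 1 + (\<Sum>d\<in>{1..t}. f d)"
      by (intro add_left_mono sum_mono) (use S[OF c] in auto)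
    finally show "real (card (T c)) \<le> b" using b by linarith
  qed
  have T_hit: "\<exists>s\<in>T c. s \<in> hamming_ball n X (a i) t"
    if c: "c \<in> words n X" and i: "i < m" "hamming_dist n (a i) c \<le> 2 * t" for c i
  proof (cases "hamming_dist n (a i) c \<le> t")
    case True
    then show ?thesis using c by (auto simp: T_def hamming_ball_def hamming_dist_commute)
  next
    case False
    define d where "d = hamming_dist n (a i) c - t"
    have "d \<in> {1..t}" "hamming_dist n (a i) c = t + d" using False i(2) by (auto simp: d_def)
    then show ?thesis using S[OF c] i(1) unfolding T_def by blast
  qed
  have fM: "finite M" using M(1) finite_subset by blast
  have aM: "a j \<in> words n X" if "j \<in> M" for j using a M(1) that by auto
  define P where "P = (\<Union>j\<in>M. T (a j))"
  have "real (card P) \<le> real (\<Sum>j\<in>M. card (T (a j)))"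
    unfolding P_def using fM by (intro of_nat_mono card_UN_le)
  also have "\<dots> \<le> (\<Sum>j\<in>M. b)"
    unfolding of_nat_sum by (intro sum_mono T aM)
  also have "\<dots> \<le> real p * b"
    using \<open>card M < p\<close> b0 by (simp add: mult_right_mono)
  finally have "real (card P) \<le> real p * b" .
  moreover have "\<exists>s\<in>P. s \<in> hamming_ball n X (a i) t" if "i < m" for i
    using covM[OF that] T_hit[OF aM that] unfolding cov_def P_def by blast
  moreover have "P \<subseteq> words n X" "finite P"
    using T[OF aM] fM by (auto simp: P_def)
  ultimately show ?thesis unfolding pierceable_def by blast
qed

section \<open>Counting the points used\<close>

lemma card_Union_diff_graph_le:
  assumes "M \<subseteq> {..<m::nat}" "card M < p" "\<And>w. w \<in> M \<Longrightarrow> hamming_dist n (a w) c = s"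
  shows "finite (\<Union>w\<in>M. diff_graph n c (a w))" "card (\<Union>w\<in>M. diff_graph n c (a w)) \<le> s * p"
proof -
  have fM: "finite M" using assms(1) finite_subset by blast
  then show "finite (\<Union>w\<in>M. diff_graph n c (a w))" by simp
  have "card (\<Union>w\<in>M. diff_graph n c (a w)) \<le> (\<Sum>w\<in>M. card (diff_graph n c (a w)))"
    using fM by (rule card_UN_le)
  also have "\<dots> = card M * s" using assms(3) by (simp add: card_diff_graph)
  also have "\<dots> \<le> s * p" using assms(2) by (simp add: mult.commute)
  finally show "card (\<Union>w\<in>M. diff_graph n c (a w)) \<le> s * p" .
qed

lemma exp_partial_sum_le:
  fixes x :: real
  assumes "0 \<le> x"
  shows "(\<Sum>d\<le>t. x ^ d / fact d) \<le> exp x"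
proof -
  have "(\<Sum>d\<in>{..t}. x ^ d /\<^sub>R fact d) \<le> (\<Sum>d. x ^ d /\<^sub>R fact d)"
    using assms by (intro sum_le_suminf summable_exp_generic) auto
  then show ?thesis by (simp add: exp_def divide_inverse mult.commute)
qed

lemma exp_term_le:
  fixes x :: real
  assumes "0 \<le> x"
  shows "x ^ d / fact d \<le> exp x"
proof -
  have "x ^ d / fact d \<le> (\<Sum>d\<le>d. x ^ d / fact d)"
    using assms by (intro member_le_sum) auto
  then show ?thesis using exp_partial_sum_le[OF assms, of d] by linarith
qed

text \<open>The two factors are treated differently: \<open>A\<close> becomes \<open>2 * t\<close>
  and is absorbed with the factorial into an exponential, while \<open>B\<close>, which is
  \<open>p\<close> or \<open>card X\<close>, remains as a power.\<close>

lemma binomial_le_power_div_fact: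
  assumes "N \<le> A * B"
  shows "real (N choose d) \<le> real B ^ d * (real A ^ d / fact d)"
proof -
  have "real (N choose d) * fact d \<le> real N ^ d"
    using binomial_fact_pow[of N d] by (metis of_nat_fact of_nat_le_iff of_nat_mult of_nat_power)
  also have "\<dots> \<le> (real A * real B) ^ d"
    using assms by (intro power_mono) (simp_all flip: of_nat_mult)
  finally show ?thesis by (simp add: field_simps power_mult_distrib)
qed

text \<open>Here \<open>t + 2 - q = 0\<close>, so \<open>K\<close> is empty and only
  \<open>d\<close>-element subsets of \<open>U\<close> are counted. Summing over \<open>d\<close>
  yields \<open>exp (2 * t)\<close>; the last factor \<open>p\<close> comes from the number of
  reference words.\<close>

lemma pierceable_top:
  fixes a :: "nat \<Rightarrow> nat \<Rightarrow> 'a"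
  assumes pq: "pq_property p q m (\<lambda>i. hamming_ball n X (a i) t)" and q: "q = t + 2" and p: "0 < p"
    and a: "\<And>i. i < m \<Longrightarrow> a i \<in> words n X"
  shows "pierceable (words n X) m (\<lambda>i. hamming_ball n X (a i) t) (exp (2 * real t) * real p ^ (t + 1))"
proof -
  \<comment> \<open>The power \<open>p ^ t\<close> replaces \<open>p ^ d\<close> so that it factors
    out of the sum over \<open>d\<close>.\<close>
  define f where "f d = real p ^ t * (real (2 * t) ^ d / fact d)" for d
  have layer: "\<exists>S\<subseteq>words n X. finite S \<and> real (card S) \<le> f d \<and>
        (\<forall>i<m. hamming_dist n (a i) c = t + d \<longrightarrow> (\<exists>s\<in>S. s \<in> hamming_ball n X (a i) t))"
    if c: "c \<in> words n X" and d: "d \<in> {1..t}" for c d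
  proof -
    have q2: "2 \<le> q" "q \<le> t + 2" using q by auto
    obtain M where M: "M \<subseteq> {..<m}" "card M < p"
      "\<And>w. w \<in> M \<Longrightarrow> hamming_dist n (a w) c = t + d"
      and hit: "\<And>i. i < m \<Longrightarrow> hamming_dist n (a i) c = t + d \<Longrightarrow> \<exists>w\<in>M. \<exists>K L.
         finite K \<and> K \<subseteq> diff_support n c (a w) \<times> X \<and> card K = min (t + 2 - q) d \<and>
         L \<subseteq> (\<Union>w\<in>M. diff_graph n c (a w)) \<and> card L = d - (t + 2 - q) \<and>
         override_graph c (K \<union> L) \<in> hamming_ball n X (a i) t"
      by (rule layer_pierced[OF pq q2 c a, where d = d]) (assumption, (rule that; assumption))
    define U where "U = (\<Union>w\<in>M. diff_graph n c (a w))"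
    have U: "finite U" "card U \<le> (t + d) * p"
      using card_Union_diff_graph_le[OF M] by (simp_all add: U_def)
    have UX: "U \<subseteq> {..<n} \<times> X"
      unfolding U_def using diff_graph_subset[OF a] M(1) by blast
    define S where "S = override_graph c ` {L. L \<subseteq> U \<and> card L = d}"
    have "real (card S) \<le> real (card U choose d)"
      unfolding S_def using U(1) by (subst n_subsets[symmetric]) (auto intro: card_image_le)
    also have "\<dots> \<le> real p ^ d * (real (2 * t) ^ d / fact d)"
      using U(2) d by (intro binomial_le_power_div_fact) (auto elim!: order_trans)
    also have "\<dots> \<le> f d"
      unfolding f_def using p d by (intro mult_right_mono power_increasing) auto
    finally have "real (card S) \<le> f d" .
    moreover have "S \<subseteq> words n X" "finite S"
      using U(1) UX override_graph_words[OF c] unfolding S_def by auto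
    moreover have "\<exists>s\<in>S. s \<in> hamming_ball n X (a i) t"
      if i: "i < m" "hamming_dist n (a i) c = t + d" for i
    proof -
      obtain K L where "finite K" "card K = min (t + 2 - q) d" "L \<subseteq> U" "card L = d - (t + 2 - q)"
        "override_graph c (K \<union> L) \<in> hamming_ball n X (a i) t"
        using hit[OF i] unfolding U_def[symmetric] by blast
      moreover from this q have "K = {}" "card L = d" by auto
      ultimately show ?thesis unfolding S_def by auto
    qed
    ultimately show ?thesis by blast
  qed
  \<comment> \<open>The point \<open>c\<close> is charged to the summand \<open>d = 0\<close>,
    completing the exponential sum.\<close>
  have "1 \<le> f 0"
    using p by (simp add: f_def one_le_power)
  then have "1 + (\<Sum>d\<in>{1..t}. f d) \<le> f 0 + (\<Sum>d\<in>{1..t}. f d)"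
    by (rule add_right_mono)
  also have "\<dots> = (\<Sum>d\<le>t. f d)"
    by (simp add: atMost_atLeast0 sum.atLeast_Suc_atMost)
  also have "\<dots> = real p ^ t * (\<Sum>d\<le>t. real (2 * t) ^ d / fact d)"
    by (simp add: f_def sum_distrib_left)
  also have "\<dots> \<le> real p ^ t * exp (real (2 * t))"
    by (intro mult_left_mono exp_partial_sum_le) auto
  finally have "pierceable (words n X) m (\<lambda>i. hamming_ball n X (a i) t)
      (real p * (real p ^ t * exp (real (2 * t))))"
    using q by (intro pierceable_from_layers[OF pq _ a layer]) auto
  then show ?thesis by (simp add: mult_ac)
qed

text \<open>One factor \<open>p\<close> counts reference words, one the choice of \<open>w\<close>,
  and \<open>q - 2\<close> come with \<open>L\<close>. The exponent \<open>5 * t\<close> collects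
  \<open>2 * t\<close> each from \<open>K\<close> and \<open>L\<close> and \<open>t\<close> from the
  number of layers.\<close>

lemma pierceable_finite:
  fixes a :: "nat \<Rightarrow> nat \<Rightarrow> 'a"
  assumes pq: "pq_property p q m (\<lambda>i. hamming_ball n X (a i) t)"
    and q: "2 \<le> q" "q \<le> t + 1" and p: "0 < p"
    and a: "\<And>i. i < m \<Longrightarrow> a i \<in> words n X" and X: "finite X" "X \<noteq> {}"
  shows "pierceable (words n X) m (\<lambda>i. hamming_ball n X (a i) t)
    (real p ^ q * real (card X) ^ (t + 2 - q) * exp (5 * real t))"
proof -
  define k where "k = t + 2 - q"
  \<comment> \<open>A bound for one layer, uniform in \<open>d\<close>: the factors count the
    choices of \<open>w\<close>, \<open>K\<close> and \<open>L\<close>.\<close>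
  define Y where "Y = real p * (real (card X) ^ k * exp (2 * real t) * (real p ^ (q - 2) * exp (2 * real t)))"
  have X1: "1 \<le> card X" using X by (simp add: Suc_leI card_gt_0_iff)
  have layer: "\<exists>S\<subseteq>words n X. finite S \<and> real (card S) \<le> Y \<and>
        (\<forall>i<m. hamming_dist n (a i) c = t + d \<longrightarrow> (\<exists>s\<in>S. s \<in> hamming_ball n X (a i) t))"
    if c: "c \<in> words n X" and d: "d \<in> {1..t}" for c d
  proof -
    have q2: "q \<le> t + 2" using q by auto
    obtain M where M: "M \<subseteq> {..<m}" "card M < p"
      "\<And>w. w \<in> M \<Longrightarrow> hamming_dist n (a w) c = t + d"
      and hit: "\<And>i. i < m \<Longrightarrow> hamming_dist n (a i) c = t + d \<Longrightarrow> \<exists>w\<in>M. \<exists>K L.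
         finite K \<and> K \<subseteq> diff_support n c (a w) \<times> X \<and> card K = min (t + 2 - q) d \<and>
         L \<subseteq> (\<Union>w\<in>M. diff_graph n c (a w)) \<and> card L = d - (t + 2 - q) \<and>
         override_graph c (K \<union> L) \<in> hamming_ball n X (a i) t"
      by (rule layer_pierced[OF pq q(1) q2 c a, where d = d]) (assumption, (rule that; assumption))
    have fM: "finite M" using M(1) finite_subset by blast
    define U where "U = (\<Union>w\<in>M. diff_graph n c (a w))"
    have U: "finite U" "card U \<le> (t + d) * p"
      using card_Union_diff_graph_le[OF M] by (simp_all add: U_def)
    have UX: "U \<subseteq> {..<n} \<times> X"
      unfolding U_def using diff_graph_subset[OF a] M(1) by blast
    define KS where "KS w = {K. K \<subseteq> diff_support n c (a w) \<times> X \<and> card K = min k d}" for w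
    define LS where "LS = {L. L \<subseteq> U \<and> card L = d - k}"
    define S where "S = (\<Union>w\<in>M. (\<lambda>(K, L). override_graph c (K \<union> L)) ` (KS w \<times> LS))"
    have fin: "finite (KS w)" "finite LS" for w
      using U(1) X(1) by (simp_all add: KS_def LS_def)
    have "real (card LS) = real (card U choose (d - k))"
      unfolding LS_def using U(1) by (simp add: n_subsets)
    also have "\<dots> \<le> real p ^ (d - k) * (real (2 * t) ^ (d - k) / fact (d - k))"
      using U(2) d by (intro binomial_le_power_div_fact) (auto elim!: order_trans)
    \<comment> \<open>Since \<open>d \<le> t\<close>, the exponent \<open>d - k\<close> is at most
      \<open>t - k = q - 2\<close>.\<close>
    also have "\<dots> \<le> real p ^ (q - 2) * exp (real (2 * t))"
      using p d q by (intro mult_mono power_increasing exp_term_le) (auto simp: k_def)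
    finally have LS: "real (card LS) \<le> real p ^ (q - 2) * exp (2 * real t)" by simp
    have KS: "real (card (KS w)) \<le> real (card X) ^ k * exp (2 * real t)" if "w \<in> M" for w
    proof -
      have "real (card (KS w)) = real (((t + d) * card X) choose min k d)"
        unfolding KS_def using X(1) M(3)[OF that]
        by (simp add: n_subsets card_diff_support card_cartesian_product)
      also have "\<dots> \<le> real (card X) ^ min k d * (real (2 * t) ^ min k d / fact (min k d))"
        using d by (intro binomial_le_power_div_fact) auto
      also have "\<dots> \<le> real (card X) ^ k * exp (real (2 * t))"
        using X1 by (intro mult_mono power_increasing exp_term_le) auto
      finally show ?thesis by simp
    qed
    have "card S \<le> (\<Sum>w\<in>M. card ((\<lambda>(K, L). override_graph c (K \<union> L)) ` (KS w \<times> LS)))"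
      unfolding S_def using fM by (rule card_UN_le)
    also have "\<dots> \<le> (\<Sum>w\<in>M. card (KS w \<times> LS))"
      by (intro sum_mono card_image_le finite_cartesian_product fin)
    finally have "card S \<le> (\<Sum>w\<in>M. card (KS w) * card LS)" by (simp add: card_cartesian_product)
    then have "real (card S) \<le> (\<Sum>w\<in>M. real (card (KS w)) * real (card LS))"
      by (simp flip: of_nat_sum of_nat_mult)
    also have "\<dots> \<le> (\<Sum>w\<in>M. real (card X) ^ k * exp (2 * real t) * (real p ^ (q - 2) * exp (2 * real t)))"
      by (intro sum_mono mult_mono KS LS) auto
    also have "\<dots> \<le> Y"
      using M(2) unfolding Y_def by (simp add: mult_right_mono)
    finally have "real (card S) \<le> Y" .
    moreover have "S \<subseteq> words n X"
    proof
      fix x assume "x \<in> S"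
      then obtain w K L where KL: "K \<in> KS w" "L \<in> LS" and x: "x = override_graph c (K \<union> L)"
        by (auto simp: S_def)
      from KL UX have "K \<union> L \<subseteq> {..<n} \<times> X"
        by (auto simp: KS_def LS_def diff_support_def)
      then show "x \<in> words n X" unfolding x by (rule override_graph_words[OF c])
    qed
    moreover have "finite S" using fM fin by (auto simp: S_def)
    moreover have "\<exists>s\<in>S. s \<in> hamming_ball n X (a i) t"
      if i: "i < m" "hamming_dist n (a i) c = t + d" for i
    proof -
      obtain w where w: "w \<in> M" and "\<exists>K L. finite K \<and> K \<subseteq> diff_support n c (a w) \<times> X \<and>
          card K = min k d \<and> L \<subseteq> U \<and> card L = d - k \<and>
          override_graph c (K \<union> L) \<in> hamming_ball n X (a i) t"
        using hit[OF i, folded U_def k_def] by (elim bexE) (rule that)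
      then obtain K L where KL: "K \<subseteq> diff_support n c (a w) \<times> X \<and>
          card K = min k d \<and> L \<subseteq> U \<and> card L = d - k"
        and ball: "override_graph c (K \<union> L) \<in> hamming_ball n X (a i) t"
        by (elim exE conjE) (rule that; simp)
      then have "K \<in> KS w" "L \<in> LS" by (simp_all add: KS_def LS_def)
      then have "override_graph c (K \<union> L) \<in> S"
        unfolding S_def using w by (intro UN_I[of w] image_eqI[of _ _ "(K, L)"]) simp_all
      with ball show ?thesis ..
    qed
    ultimately show ?thesis by blast
  qed
  have ge1: "1 \<le> x * y" if "1 \<le> x" "1 \<le> y" for x y :: real
    using mult_mono[of 1 x 1 y] that by simp
  have Y1: "1 \<le> Y"
    unfolding Y_def using p X1 by (intro ge1 one_le_power) auto
  \<comment> \<open>As \<open>Y \<ge> 1\<close>, the reference word and the \<open>t\<close> layers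
    together cost at most \<open>1 + t\<close> times \<open>Y\<close>, and
    \<open>1 + t \<le> exp t\<close>.\<close>
  have "1 + (\<Sum>d\<in>{1..t}. Y) \<le> (1 + real t) * Y"
    using Y1 by (simp add: algebra_simps)
  also have "\<dots> \<le> exp (real t) * Y"
    using Y1 by (intro mult_right_mono exp_ge_add_one_self) auto
  finally have "pierceable (words n X) m (\<lambda>i. hamming_ball n X (a i) t) (real p * (exp (real t) * Y))"
    using q Y1 by (intro pierceable_from_layers[OF pq _ a layer]) auto
  moreover have "real p * (exp (real t) * Y) = real p ^ q * real (card X) ^ k * exp (5 * real t)"
  proof -
    have "real p ^ q = real p * real p * real p ^ (q - 2)"
      using q(1) by (metis add_diff_inverse_nat not_less power_add power2_eq_square)
    moreover have "exp (5 * real t) = exp (real t) * (exp (2 * real t) * exp (2 * real t))"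
      by (simp flip: exp_add)
    ultimately show ?thesis by (simp add: Y_def mult_ac)
  qed
  ultimately show ?thesis by (simp add: k_def)
qed

lemma pierceable_mono: "pierceable V m B N \<Longrightarrow> N \<le> N' \<Longrightarrow> pierceable V m B N'"
  unfolding pierceable_def by (meson order_trans)

text \<open>The constant is read off from \<open>exp (5 * t)\<close> in the finite case. Both
  estimates reach the required shape through a factor at least 1: \<open>q ^ t\<close> there, and
  \<open>exp 5\<close> when \<open>q = t + 2\<close>.\<close>

lemma piercing_bounds_exp5:
  assumes "X \<noteq> {}"
  shows "piercing_bounds (exp 5) X"
  unfolding piercing_bounds_def
proof (intro allI impI conjI; elim conjE)
  fix m n t p q and a :: "nat \<Rightarrow> nat \<Rightarrow> 'a"
  assume pq: "pq_property p q m (\<lambda>i. hamming_ball n X (a i) t)"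
    and p: "q \<le> p" and q: "2 \<le> q" and a: "\<forall>i<m. a i \<in> words n X"
  {
    assume "finite X" "q \<le> t + 1"
    then have "pierceable (words n X) m (\<lambda>i. hamming_ball n X (a i) t)
        (real p ^ q * real (card X) ^ (t + 2 - q) * exp (5 * real t))"
      using pierceable_finite[OF pq q] a p q assms by auto
    moreover have "real p ^ q * real (card X) ^ (t + 2 - q) * exp (5 * real t) \<le>
        real q ^ t * (real p ^ q * real (card X) ^ (t + 2 - q) * exp (5 * real t))"
      using mult_right_mono[OF one_le_power[of "real q" t]] q by fastforce
    moreover have "exp (5 * real t) = exp 5 ^ t"
      by (metis exp_of_nat_mult mult.commute)
    ultimately show "pierceable (words n X) m (\<lambda>i. hamming_ball n X (a i) t)
        (real p ^ q * real q ^ t * real (card X) ^ (t + 2 - q) * exp 5 ^ t)"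
      by (elim pierceable_mono) (simp add: mult_ac)
  next
    assume "q = t + 2"
    then have "pierceable (words n X) m (\<lambda>i. hamming_ball n X (a i) t)
        (exp (2 * real t) * real p ^ (t + 1))"
      using pierceable_top[OF pq] a p q by auto
    moreover have "exp (2 * real t) * real p ^ (t + 1) \<le> exp 5 * (exp (2 * real t) * real p ^ (t + 1))"
      using mult_right_mono[of 1 "exp 5" "exp (2 * real t) * real p ^ (t + 1)"] by simp
    ultimately show "pierceable (words n X) m (\<lambda>i. hamming_ball n X (a i) t)
        (exp 5 * exp (2 * real t) * real p ^ (t + 1))"
      by (elim pierceable_mono) (simp add: mult_ac)
  }
qed

section \<open>Passage to alphabets of natural numbers\<close>

text \<open>Only letters of the centres matter: replacing any other letter of a common point does not
  increase its distance to the centres.\<close>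

lemma nat_alphabet:
  fixes a :: "nat \<Rightarrow> nat \<Rightarrow> 'a"
  assumes mn: "1 \<le> m" "0 < n" and a: "\<And>i. i < m \<Longrightarrow> a i \<in> words n X"
    and pq: "pq_property p q m (\<lambda>i. hamming_ball n X (a i) t)"
  obtains b and Y :: "nat set" where "finite Y" "Y \<noteq> {}" "\<And>i. i < m \<Longrightarrow> b i \<in> words n Y"
    "pq_property p q m (\<lambda>i. hamming_ball n Y (b i) t)"
    "finite X \<Longrightarrow> card Y \<le> card X"
    "\<And>N. pierceable (words n Y) m (\<lambda>i. hamming_ball n Y (b i) t) N \<Longrightarrow>
         pierceable (words n X) m (\<lambda>i. hamming_ball n X (a i) t) N"
proof -
  define Z where "Z = (\<Union>i<m. a i ` {..<n})"
  have Z: "finite Z" "Z \<subseteq> X" using a by (auto simp: Z_def PiE_iff)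
  have aZ: "a i j \<in> Z" if "i < m" "j < n" for i j using that by (auto simp: Z_def)
  \<comment> \<open>A default letter. It exists because there is at least one centre and one
    coordinate, and it makes \<open>Y\<close> nonempty.\<close>
  obtain z where z: "z \<in> Z" using aZ mn by (metis less_le_trans zero_less_one)
  obtain f :: "'a \<Rightarrow> nat" where f: "inj_on f Z" using finite_imp_inj_to_nat_seg[OF Z(1)] by blast
  define g where "g = inv_into Z f"
  have gf: "g (f x) = x" if "x \<in> Z" for x using that f by (simp add: g_def)
  define Y where "Y = f ` Z"
  define b where "b i = restrict (f \<circ> a i) {..<n}" for i
  have bY: "b i \<in> words n Y" if "i < m" for i
    using aZ[OF that] by (auto simp: b_def Y_def)
  have bpq: "pq_property p q m (\<lambda>i. hamming_ball n Y (b i) t)"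
    unfolding pq_property_def
  proof (intro allI impI)
    fix I assume I: "I \<subseteq> {..<m}" "card I = p"
    then obtain J y where J: "J \<subseteq> I" "card J = q" "\<forall>j\<in>J. y \<in> hamming_ball n X (a j) t"
      using pq unfolding pq_property_def by blast
    \<comment> \<open>Where \<open>y\<close> agrees with a centre its letter lies in
      \<open>Z\<close> and is kept, so no agreement is lost.\<close>
    define y' where "y' = restrict (\<lambda>i. f (if y i \<in> Z then y i else z)) {..<n}"
    have "y' \<in> words n Y" using z by (auto simp: y'_def Y_def)
    moreover have "hamming_dist n y' (b j) \<le> t" if "j \<in> J" for j
    proof -
      have "hamming_dist n y' (b j) \<le> hamming_dist n y (a j)"
        unfolding hamming_dist_def using that J(1) I(1) aZ
        by (intro card_mono) (auto simp: y'_def b_def)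
      then show ?thesis using J(3) that by (auto simp: hamming_ball_def)
    qed
    ultimately have "\<forall>j\<in>J. y' \<in> hamming_ball n Y (b j) t" by (simp add: hamming_ball_def)
    then show "\<exists>J\<subseteq>I. card J = q \<and> (\<exists>y. \<forall>j\<in>J. y \<in> hamming_ball n Y (b j) t)"
      using J(1,2) by blast
  qed
  have pull: "pierceable (words n X) m (\<lambda>i. hamming_ball n X (a i) t) N"
    if "pierceable (words n Y) m (\<lambda>i. hamming_ball n Y (b i) t) N" for N
  proof -
    obtain S where S: "S \<subseteq> words n Y" "finite S" "real (card S) \<le> N"
      "\<forall>i<m. \<exists>s\<in>S. s \<in> hamming_ball n Y (b i) t"
      using \<open>pierceable (words n Y) m _ N\<close> unfolding pierceable_def by blast
    define h where "h s = restrict (g \<circ> s) {..<n}" for s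
    have h: "h s \<in> words n X" if "s \<in> words n Y" for s
    proof -
      have "g (s j) \<in> X" if "j < n" for j
      proof -
        have "s j \<in> f ` Z" using \<open>s \<in> words n Y\<close> that by (auto simp: Y_def PiE_iff)
        then show ?thesis using Z(2) gf by auto
      qed
      then show ?thesis by (simp add: h_def PiE_iff)
    qed
    have hd: "hamming_dist n (h s) (a i) \<le> hamming_dist n s (b i)" if "i < m" for s i
    proof -
      \<comment> \<open>Agreement with \<open>b i\<close> decodes to agreement with
        \<open>a i\<close>, because \<open>g\<close> inverts \<open>f\<close> on
        \<open>Z\<close>.\<close>
      have "h s j = a i j" if "j < n" "s j = b i j" for j
        using that gf[OF aZ[OF \<open>i < m\<close> \<open>j < n\<close>]] by (simp add: h_def b_def)
      then show ?thesis unfolding hamming_dist_def by (intro card_mono) auto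
    qed
    have "\<exists>s\<in>h ` S. s \<in> hamming_ball n X (a i) t" if "i < m" for i
    proof -
      obtain s where "s \<in> S" "s \<in> hamming_ball n Y (b i) t" using S(4) \<open>i < m\<close> by blast
      then show ?thesis
        using h[of s] hd[OF \<open>i < m\<close>, of s] by (auto simp: hamming_ball_def)
    qed
    moreover have "real (card (h ` S)) \<le> N"
      using card_image_le[OF S(2), of h] S(3) by linarith
    moreover have "h ` S \<subseteq> words n X" "finite (h ` S)" using h S(1,2) by auto
    ultimately show ?thesis unfolding pierceable_def by blast
  qed
  have "card Y \<le> card X" if "finite X"
    using card_image_le[OF Z(1), of f] card_mono[OF that Z(2)] by (simp add: Y_def)
  moreover have "finite Y" "Y \<noteq> {}" using z Z(1) by (auto simp: Y_def)
  ultimately show thesis using bY bpq pull by (intro that)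
qed

text \<open>The system is recoded over a finite alphabet \<open>Y\<close> with
  \<open>card Y \<le> card X\<close> when \<open>X\<close> is finite, and \<open>0 < C\<close> makes
  the first bound monotone in the alphabet size. The second bound does not involve that size and
  carries over unchanged.\<close>

lemma piercing_bounds_from_nat:
  fixes X :: "'a set"
  assumes C: "0 < C" and nat: "\<And>Y :: nat set. Y \<noteq> {} \<Longrightarrow> piercing_bounds C Y"
  shows "piercing_bounds C X"
  unfolding piercing_bounds_def
proof (intro allI impI; elim conjE)
  fix m n t p q and a :: "nat \<Rightarrow> nat \<Rightarrow> 'a"
  assume m: "1 \<le> m" and n: "t < n" and p: "q \<le> p" and q: "2 \<le> q"
    and a: "\<forall>i<m. a i \<in> words n X"
    and pq: "pq_property p q m (\<lambda>i. hamming_ball n X (a i) t)"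
  have n0: "0 < n" using n by simp
  obtain b and Y :: "nat set" where finY: "finite Y" and Y: "Y \<noteq> {}" and b: "\<And>i. i < m \<Longrightarrow> b i \<in> words n Y"
    and bpq: "pq_property p q m (\<lambda>i. hamming_ball n Y (b i) t)"
    and card: "finite X \<Longrightarrow> card Y \<le> card X"
    and pull: "\<And>N. pierceable (words n Y) m (\<lambda>i. hamming_ball n Y (b i) t) N \<Longrightarrow>
         pierceable (words n X) m (\<lambda>i. hamming_ball n X (a i) t) N"
    by (rule nat_alphabet[OF m n0 a[rule_format] pq]) (assumption, (rule that; assumption))
  have "m \<ge> 1 \<and> n > t \<and> p \<ge> q \<and> q \<ge> 2 \<and> (\<forall>i<m. b i \<in> words n Y) \<and>
      pq_property p q m (\<lambda>i. hamming_ball n Y (b i) t)"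
    using m n p q b bpq by simp
  then have bound:
    "(finite Y \<and> q \<le> t + 1 \<longrightarrow> pierceable (words n Y) m (\<lambda>i. hamming_ball n Y (b i) t)
        (real p ^ q * real q ^ t * real (card Y) ^ (t + 2 - q) * C ^ t)) \<and>
     (q = t + 2 \<longrightarrow> pierceable (words n Y) m (\<lambda>i. hamming_ball n Y (b i) t)
        (C * exp (2 * real t) * real p ^ (t + 1)))"
    using nat[OF Y] unfolding piercing_bounds_def by blast
  show "(finite X \<and> q \<le> t + 1 \<longrightarrow>
             pierceable (words n X) m (\<lambda>i. hamming_ball n X (a i) t)
               (real p ^ q * real q ^ t * real (card X) ^ (t + 2 - q) * C ^ t)) \<and>
          (q = t + 2 \<longrightarrow>
             pierceable (words n X) m (\<lambda>i. hamming_ball n X (a i) t)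
               (C * exp (2 * real t) * real p ^ (t + 1)))"
  proof (intro conjI impI; (elim conjE)?)
    assume X: "finite X" and qt: "q \<le> t + 1"
    have "pierceable (words n X) m (\<lambda>i. hamming_ball n X (a i) t)
        (real p ^ q * real q ^ t * real (card Y) ^ (t + 2 - q) * C ^ t)"
      using bound finY qt pull by blast
    moreover have "real p ^ q * real q ^ t * real (card Y) ^ (t + 2 - q) * C ^ t \<le>
        real p ^ q * real q ^ t * real (card X) ^ (t + 2 - q) * C ^ t"
      using C card[OF X] by (intro mult_right_mono mult_left_mono power_mono) auto
    ultimately show "pierceable (words n X) m (\<lambda>i. hamming_ball n X (a i) t)
        (real p ^ q * real q ^ t * real (card X) ^ (t + 2 - q) * C ^ t)"
      by (rule pierceable_mono)
  next
    assume "q = t + 2"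
    then show "pierceable (words n X) m (\<lambda>i. hamming_ball n X (a i) t)
        (C * exp (2 * real t) * real p ^ (t + 1))"
      using bound pull by blast
  qed
qed

theorem theorem4p2:
  shows "(\<exists>C>0. \<forall>X :: nat set. X \<noteq> {} \<longrightarrow> piercing_bounds C X) \<and>
         (\<forall>C>0. (\<forall>X :: nat set. X \<noteq> {} \<longrightarrow> piercing_bounds C X) \<longrightarrow>
                (\<forall>X :: 'a set. X \<noteq> {} \<longrightarrow> piercing_bounds C X))"
proof
  show "\<exists>C>0. \<forall>X :: nat set. X \<noteq> {} \<longrightarrow> piercing_bounds C X"
    using piercing_bounds_exp5 exp_gt_zero by blast
  show "\<forall>C>0. (\<forall>X :: nat set. X \<noteq> {} \<longrightarrow> piercing_bounds C X) \<longrightarrow>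
                (\<forall>X :: 'a set. X \<noteq> {} \<longrightarrow> piercing_bounds C X)"
    using piercing_bounds_from_nat by blast
qed

end
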